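(* If a metric space $(X,d)$ has uniform dimension $\dim_u(X)\le 0$, then there is an ultrametric $\rho$ on $X$ such that the identity map $\mathrm{id}\colon (X,d)\to (X,\rho)$ is bi-uniform.
   Context: Write $\mathbb{R}_+=[0,\infty)$. For $S>0$ and a metric space $X$, an $S$-chain is a finite sequence $x_1,\dots,x_k$ of points of $X$ with $d(x_i,x_{i+1})\le S$ for all $i<k$. A subset is $S$-connected if any two of its points can be joined by an $S$-chain inside the subset; the $S$-components of $X$ are its maximal $S$-connected subsets. A subset is $D$-bounded if any two of its points are at distance $\le D$. $X$ has uniform dimension zero, written $\dim_u(X)\le 0$, if there is a continuous increasing function $\mathcal{D}\colon\mathbb{R}_+\to\mathbb{R}_+$ with $\mathcal{D}(0)=0$ and $\lim_{t\to\infty}\mathcal{D}(t)=\infty$ such that for every $S>0$ every $S$-component of $X$ is $\mathcal{D}(S)$-bounded. (Here "increasing" and "continuous" guarantee that $\mathcal{D}$ has an inverse function.) A metric $\rho$ on $X$ is an ultrametric if $\rho(x,z)\le\max\{\rho(x,y),\rho(y,z)\}$ for all $x,y,z\in X$. A map $f\colon X\to Y$ of metric spaces is uniform if there is a function $\delta_f\colon\mathbb{R}_+\to\mathbb{R}_+$ with $\lim_{t\to0}\delta_f(t)=0$ such that $d_Y(f(x),f(x'))\le\delta_f(d_X(x,x'))$ for all $x,x'\in X$. A map $f$ is bi-uniform if both $f$ and $f^{-1}$ are uniform. *)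

theory Defs
  imports "HOL-Analysis.Analysis"
begin

text \<open>
  All notions are stated for a metric space given by a carrier \<open>M\<close> and a distance \<open>d\<close>, as in the
  library locale \<open>Metric_space\<close>. Functions on the half-line \<open>[0, \<infinity>)\<close> are total functions on
  the reals of which only the restriction to \<open>{0..}\<close> matters.
\<close>

definition S_chain :: "('a \<Rightarrow> 'a \<Rightarrow> real) \<Rightarrow> real \<Rightarrow> 'a list \<Rightarrow> bool" where
  "S_chain d S xs \<longleftrightarrow> xs \<noteq> [] \<and> (\<forall>i. Suc i < length xs \<longrightarrow> d (xs ! i) (xs ! Suc i) \<le> S)"

definition S_connected :: "('a \<Rightarrow> 'a \<Rightarrow> real) \<Rightarrow> real \<Rightarrow> 'a set \<Rightarrow> bool" where
  "S_connected d S A \<longleftrightarrow>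
     (\<forall>x\<in>A. \<forall>y\<in>A. \<exists>xs. S_chain d S xs \<and> set xs \<subseteq> A \<and> hd xs = x \<and> last xs = y)"

definition S_component :: "'a set \<Rightarrow> ('a \<Rightarrow> 'a \<Rightarrow> real) \<Rightarrow> real \<Rightarrow> 'a set \<Rightarrow> bool" where
  "S_component M d S C \<longleftrightarrow>
     C \<subseteq> M \<and> S_connected d S C \<and>
     (\<forall>C'. C \<subseteq> C' \<and> C' \<subseteq> M \<and> S_connected d S C' \<longrightarrow> C' = C)"

definition D_bounded :: "('a \<Rightarrow> 'a \<Rightarrow> real) \<Rightarrow> real \<Rightarrow> 'a set \<Rightarrow> bool" where
  "D_bounded d D A \<longleftrightarrow> (\<forall>x\<in>A. \<forall>y\<in>A. d x y \<le> D)"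

text \<open>
  ``Increasing'' is strict, since the control function is meant to be invertible. It maps
  \<open>[0, \<infinity>)\<close> into itself automatically, being increasing with value \<open>0\<close> at \<open>0\<close>.
\<close>

definition uniform_dim_le_0 :: "'a set \<Rightarrow> ('a \<Rightarrow> 'a \<Rightarrow> real) \<Rightarrow> bool" where
  "uniform_dim_le_0 M d \<longleftrightarrow>
     (\<exists>D :: real \<Rightarrow> real.
        continuous_on {0..} D \<and> strict_mono_on {0..} D \<and> D 0 = 0 \<and> filterlim D at_top at_top \<and>
        (\<forall>S>0. \<forall>C. S_component M d S C \<longrightarrow> D_bounded d (D S) C))"

definition ultrametric_on :: "'a set \<Rightarrow> ('a \<Rightarrow> 'a \<Rightarrow> real) \<Rightarrow> bool" where
  "ultrametric_on M \<rho> \<longleftrightarrow>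
     Metric_space M \<rho> \<and> (\<forall>x\<in>M. \<forall>y\<in>M. \<forall>z\<in>M. \<rho> x z \<le> max (\<rho> x y) (\<rho> y z))"

text \<open>
  The modulus \<open>\<delta>\<close> is finite at every \<open>t \<ge> 0\<close>, so this also controls large distances and is stronger
  than uniform continuity. Taking the limit at \<open>0\<close> over \<open>t > 0\<close> is harmless: the value \<open>\<delta> 0\<close>
  only concerns pairs with \<open>x = x'\<close>.
\<close>

definition uniform_map ::
    "'a set \<Rightarrow> ('a \<Rightarrow> 'a \<Rightarrow> real) \<Rightarrow> 'b set \<Rightarrow> ('b \<Rightarrow> 'b \<Rightarrow> real) \<Rightarrow> ('a \<Rightarrow> 'b) \<Rightarrow> bool" where
  "uniform_map M d M' d' f \<longleftrightarrow>
     f \<in> M \<rightarrow> M' \<and>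
     (\<exists>\<delta> :: real \<Rightarrow> real.
        (\<forall>t\<ge>0. \<delta> t \<ge> 0) \<and> (\<delta> \<longlongrightarrow> 0) (at_right 0) \<and>
        (\<forall>x\<in>M. \<forall>x'\<in>M. d' (f x) (f x') \<le> \<delta> (d x x')))"

definition bi_uniform_map ::
    "'a set \<Rightarrow> ('a \<Rightarrow> 'a \<Rightarrow> real) \<Rightarrow> 'b set \<Rightarrow> ('b \<Rightarrow> 'b \<Rightarrow> real) \<Rightarrow> ('a \<Rightarrow> 'b) \<Rightarrow> bool" where
  "bi_uniform_map M d M' d' f \<longleftrightarrow>
     bij_betw f M M' \<and> uniform_map M d M' d' f \<and> uniform_map M' d' M d (inv_into M f)"

end

theory Submission
  imports Defs
begin

text \<open>
  The ultrametric \<open>\<rho> x y\<close> is the infimum of the scales \<open>S\<close> at which \<open>x\<close> and \<open>y\<close> lie in the same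
  \<open>S\<close>-component. Concatenating chains gives the strong triangle inequality, and a two-point chain
  gives \<open>\<rho> \<le> d\<close>. Conversely \<open>d x y \<le> D S\<close> for every \<open>S > \<rho> x y\<close>, so \<open>d \<le> D \<circ> \<rho>\<close> by continuity
  of the control function.
\<close>

text \<open>Chains are handled through the reflexive-transitive closure, so that concatenation,
  reversal and change of scale become facts about relations. Both endpoints of a step lie in
  \<open>M\<close>, so paths starting in \<open>M\<close> stay there; the closure still relates a
  point outside \<open>M\<close> to itself.\<close>

definition step_rel :: "'a set \<Rightarrow> ('a \<Rightarrow> 'a \<Rightarrow> real) \<Rightarrow> real \<Rightarrow> ('a \<times> 'a) set" where
  "step_rel M d S = {(x, y). x \<in> M \<and> y \<in> M \<and> d x y \<le> S}"

lemma step_rel_rtrancl_mono: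
  assumes "S \<le> T" "(x, y) \<in> (step_rel M d S)\<^sup>*"
  shows "(x, y) \<in> (step_rel M d T)\<^sup>*"
proof -
  have "step_rel M d S \<subseteq> step_rel M d T"
    using assms(1) by (auto simp: step_rel_def)
  then show ?thesis
    using assms(2) rtrancl_mono by blast
qed

lemma step_rel_rtrancl_in:
  assumes "(x, y) \<in> (step_rel M d S)\<^sup>*" "x \<in> M"
  shows "y \<in> M"
  using assms by (induction rule: rtrancl_induct) (auto simp: step_rel_def)

lemma S_chain_Cons:
  assumes "S_chain d S xs" "d x (hd xs) \<le> S"
  shows "S_chain d S (x # xs)"
  unfolding S_chain_def
proof (intro conjI allI impI)
  fix i assume i: "Suc i < length (x # xs)"
  show "d ((x # xs) ! i) ((x # xs) ! Suc i) \<le> S"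
    using assms i by (cases i) (auto simp: S_chain_def hd_conv_nth)
qed simp

lemma S_chain_ConsD:
  assumes "S_chain d S (x # xs)" "xs \<noteq> []"
  shows "S_chain d S xs" "d x (hd xs) \<le> S"
proof -
  have *: "d ((x # xs) ! i) ((x # xs) ! Suc i) \<le> S" if "Suc i < length (x # xs)" for i
    using assms(1) that by (auto simp: S_chain_def)
  show "S_chain d S xs"
    unfolding S_chain_def
  proof (intro conjI allI impI)
    fix i assume "Suc i < length xs"
    then show "d (xs ! i) (xs ! Suc i) \<le> S"
      using *[of "Suc i"] by simp
  qed (fact assms(2))
  show "d x (hd xs) \<le> S"
    using *[of 0] assms(2) by (simp add: hd_conv_nth)
qed

lemma S_chain_imp_rtrancl:
  assumes "S_chain d S xs" "set xs \<subseteq> M"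
  shows "(hd xs, last xs) \<in> (step_rel M d S)\<^sup>*"
  using assms
proof (induction xs)
  case Nil
  then show ?case by (simp add: S_chain_def)
next
  case (Cons x xs)
  show ?case
  proof (cases "xs = []")
    case False
    have "(x, hd xs) \<in> step_rel M d S"
      using S_chain_ConsD(2)[OF Cons.prems(1) False] Cons.prems(2) False
      by (auto simp: step_rel_def)
    moreover have "(hd xs, last xs) \<in> (step_rel M d S)\<^sup>*"
      using Cons.IH S_chain_ConsD(1)[OF Cons.prems(1) False] Cons.prems(2) by simp
    ultimately show ?thesis
      using False by (simp add: converse_rtrancl_into_rtrancl)
  qed simp
qed

text \<open>Every point visited on the way is itself reachable from \<open>x\<close>. Locating the
  chain in this class, and not merely in \<open>M\<close>, is what \<open>S_connected\<close> asks
  for, since its chains must run inside the subset.\<close>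

lemma rtrancl_imp_S_chain:
  assumes "(x, y) \<in> (step_rel M d S)\<^sup>*"
  shows "\<exists>xs. S_chain d S xs \<and> set xs \<subseteq> {z. (x, z) \<in> (step_rel M d S)\<^sup>*} \<and> hd xs = x \<and> last xs = y"
  using assms
proof (induction rule: converse_rtrancl_induct)
  case base
  show ?case by (rule exI[of _ "[y]"]) (simp add: S_chain_def)
next
  case (step x z)
  then obtain xs where xs: "S_chain d S xs" "set xs \<subseteq> {w. (z, w) \<in> (step_rel M d S)\<^sup>*}"
    "hd xs = z" "last xs = y"
    by blast
  have "S_chain d S (x # xs)"
    using S_chain_Cons xs(1,3) step.hyps(1) by (auto simp: step_rel_def)
  moreover have "set (x # xs) \<subseteq> {w. (x, w) \<in> (step_rel M d S)\<^sup>*}"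
    using xs(2) step.hyps(1) by (auto intro: converse_rtrancl_into_rtrancl)
  moreover have "last (x # xs) = y"
    using xs(1,4) by (auto simp: S_chain_def)
  ultimately show ?case
    by (intro exI[of _ "x # xs"]) auto
qed

context Metric_space
begin

lemma step_rel_rtrancl_sym:
  assumes "(x, y) \<in> (step_rel M d S)\<^sup>*"
  shows "(y, x) \<in> (step_rel M d S)\<^sup>*"
proof -
  have "sym (step_rel M d S)"
    by (auto simp: sym_def step_rel_def commute)
  then show ?thesis
    using assms by (meson sym_rtrancl symD)
qed

text \<open>By symmetry the class of any \<open>y\<close> in \<open>?C\<close> lies in
  \<open>?C\<close>, so the chains leaving \<open>y\<close> stay inside. For maximality, a larger
  \<open>S\<close>-connected set contains \<open>x\<close>, and its chains from \<open>x\<close> are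
  paths of steps in \<open>M\<close>, hence end in \<open>?C\<close>.\<close>

lemma S_component_rtrancl:
  assumes "x \<in> M"
  shows "S_component M d S {y. (x, y) \<in> (step_rel M d S)\<^sup>*}" (is "S_component M d S ?C")
  unfolding S_component_def
proof (intro conjI allI impI)
  show "?C \<subseteq> M"
    using assms step_rel_rtrancl_in by fast
  show "S_connected d S ?C"
    unfolding S_connected_def
  proof (intro ballI)
    fix y z assume "y \<in> ?C" "z \<in> ?C"
    then have xy: "(x, y) \<in> (step_rel M d S)\<^sup>*" and yz: "(y, z) \<in> (step_rel M d S)\<^sup>*"
      using step_rel_rtrancl_sym by (auto intro: rtrancl_trans)
    have "{w. (y, w) \<in> (step_rel M d S)\<^sup>*} \<subseteq> ?C"
      using xy by (auto intro: rtrancl_trans)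
    then show "\<exists>xs. S_chain d S xs \<and> set xs \<subseteq> ?C \<and> hd xs = y \<and> last xs = z"
      using rtrancl_imp_S_chain[OF yz] by blast
  qed
next
  fix C' assume C': "?C \<subseteq> C' \<and> C' \<subseteq> M \<and> S_connected d S C'"
  have "y \<in> ?C" if "y \<in> C'" for y
  proof -
    have "x \<in> C'" using C' by auto
    then have "\<exists>xs. S_chain d S xs \<and> set xs \<subseteq> C' \<and> hd xs = x \<and> last xs = y"
      using C' \<open>y \<in> C'\<close> by (simp add: S_connected_def)
    then obtain xs where "S_chain d S xs" "set xs \<subseteq> C'" "hd xs = x" "last xs = y"
      by (elim exE conjE)
    then show ?thesis
      using S_chain_imp_rtrancl[of d S xs M] C' by auto
  qed
  with C' show "C' = ?C" by (intro equalityI subsetI) auto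
qed

text \<open>Positive scales are those covered by the dimension hypothesis. The value 0 off
  \<open>M\<close> serves the locale \<open>Metric_space\<close>, which demands nonnegativity and
  symmetry at all points of the type.\<close>

definition chain_dist :: "'a \<Rightarrow> 'a \<Rightarrow> real" where
  "chain_dist x y =
     (if x \<in> M \<and> y \<in> M then Inf {S. S > 0 \<and> (x, y) \<in> (step_rel M d S)\<^sup>*} else 0)"

lemma chain_dist_le:
  assumes "x \<in> M" "y \<in> M" "S > 0" "(x, y) \<in> (step_rel M d S)\<^sup>*"
  shows "chain_dist x y \<le> S"
proof -
  have "bdd_below {S. S > 0 \<and> (x, y) \<in> (step_rel M d S)\<^sup>*}"
    by (rule bdd_belowI[of _ 0]) auto
  then show ?thesis
    unfolding chain_dist_def using assms by (auto intro!: cInf_lower)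
qed

lemma step_rel_rtrancl_dist:
  assumes "x \<in> M" "y \<in> M" "d x y \<le> S"
  shows "(x, y) \<in> (step_rel M d S)\<^sup>*"
  using assms by (auto simp: step_rel_def)

lemma chain_scales_nonempty:
  assumes "x \<in> M" "y \<in> M"
  shows "{S. S > 0 \<and> (x, y) \<in> (step_rel M d S)\<^sup>*} \<noteq> {}"
proof -
  \<comment> \<open>Adding 1 makes the scale positive even when \<open>x = y\<close>.\<close>
  have "d x y + 1 \<in> {S. S > 0 \<and> (x, y) \<in> (step_rel M d S)\<^sup>*}"
    using step_rel_rtrancl_dist[OF assms] by (simp add: add_nonneg_pos)
  then show ?thesis by blast
qed

lemma chain_dist_nonneg: "0 \<le> chain_dist x y"
  unfolding chain_dist_def using chain_scales_nonempty
  by (auto intro!: cInf_greatest)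

text \<open>The infimum need not be attained, but some admissible scale lies below \<open>S\<close>,
  and a chain at a smaller scale is also one at scale \<open>S\<close>.\<close>

lemma chain_dist_less_imp_rtrancl:
  assumes "x \<in> M" "y \<in> M" "chain_dist x y < S"
  shows "(x, y) \<in> (step_rel M d S)\<^sup>*"
proof -
  have "Inf {S. S > 0 \<and> (x, y) \<in> (step_rel M d S)\<^sup>*} < S"
    using assms by (simp add: chain_dist_def)
  then obtain T where "(x, y) \<in> (step_rel M d T)\<^sup>*" "T < S"
    using cInf_lessD[OF chain_scales_nonempty[OF assms(1,2)]] by blast
  then show ?thesis
    using step_rel_rtrancl_mono less_imp_le by metis
qed

lemma chain_dist_commute: "chain_dist x y = chain_dist y x"
proof -
  have "(x, y) \<in> (step_rel M d S)\<^sup>* \<longleftrightarrow> (y, x) \<in> (step_rel M d S)\<^sup>*" for S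
    using step_rel_rtrancl_sym by blast
  then show ?thesis
    by (simp add: chain_dist_def conj_commute)
qed

lemma chain_dist_le_dist:
  assumes "x \<in> M" "y \<in> M"
  shows "chain_dist x y \<le> d x y"
proof (rule field_le_epsilon)
  \<comment> \<open>The slack \<open>e\<close> keeps the scale positive when
    \<open>d x y = 0\<close>.\<close>
  fix e :: real assume "e > 0"
  then show "chain_dist x y \<le> d x y + e"
    using assms by (intro chain_dist_le step_rel_rtrancl_dist) (auto intro: add_nonneg_pos)
qed

lemma chain_dist_ultra:
  assumes "x \<in> M" "y \<in> M" "z \<in> M"
  shows "chain_dist x z \<le> max (chain_dist x y) (chain_dist y z)"
proof (rule dense_ge)
  \<comment> \<open>At any scale strictly above both distances there are chains from
    \<open>x\<close> to \<open>y\<close> and from \<open>y\<close> to \<open>z\<close>, which can be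
    joined.\<close>
  fix S assume S: "max (chain_dist x y) (chain_dist y z) < S"
  then have "(x, y) \<in> (step_rel M d S)\<^sup>*" "(y, z) \<in> (step_rel M d S)\<^sup>*"
    using assms by (auto intro: chain_dist_less_imp_rtrancl)
  then have "(x, z) \<in> (step_rel M d S)\<^sup>*"
    by (rule rtrancl_trans)
  moreover have "S > 0"
    using S chain_dist_nonneg[of x y] by simp
  ultimately show "chain_dist x z \<le> S"
    using assms by (intro chain_dist_le)
qed

lemma dist_le_chain_dist:
  assumes cont: "continuous_on {0..} D"
    and bounded: "\<And>S C. S > 0 \<Longrightarrow> S_component M d S C \<Longrightarrow> D_bounded d (D S) C"
    and xy: "x \<in> M" "y \<in> M"
  shows "d x y \<le> D (chain_dist x y)"
proof -
  let ?r = "chain_dist x y"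
  have "(D \<longlongrightarrow> D ?r) (at ?r within {0..})"
    using cont chain_dist_nonneg[of x y] by (simp add: continuous_on_def)
  \<comment> \<open>Only scales strictly above \<open>?r\<close> are sure to put \<open>x\<close>
    and \<open>y\<close> in one component, so the bound at \<open>?r\<close> is reached as a limit
    from the right.\<close>
  then have lim: "(D \<longlongrightarrow> D ?r) (at_right ?r)"
    by (rule tendsto_within_subset) (use chain_dist_nonneg[of x y] in auto)
  have "d x y \<le> D S" if "S > ?r" for S
  proof -
    have "D_bounded d (D S) {z. (x, z) \<in> (step_rel M d S)\<^sup>*}"
      using that chain_dist_nonneg[of x y] xy by (intro bounded S_component_rtrancl) auto
    then show ?thesis
      using chain_dist_less_imp_rtrancl[OF xy that] by (auto simp: D_bounded_def)
  qed
  then have "\<forall>\<^sub>F S in at_right ?r. d x y \<le> D S"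
    by (auto simp: eventually_at_filter)
  then show ?thesis
    by (rule tendsto_lowerbound[OF lim]) simp
qed

end

theorem theorem4p3:
  fixes X :: "'a set" and d :: "'a \<Rightarrow> 'a \<Rightarrow> real"
  assumes "Metric_space X d"
    and "uniform_dim_le_0 X d"
  shows "\<exists>\<rho> :: 'a \<Rightarrow> 'a \<Rightarrow> real. ultrametric_on X \<rho> \<and> bi_uniform_map X d X \<rho> id"
proof -
  interpret Metric_space X d by fact
  obtain D :: "real \<Rightarrow> real" where cont: "continuous_on {0..} D"
    and mono: "strict_mono_on {0..} D" and D0: "D 0 = 0"
    and bounded: "\<And>S C. S > 0 \<Longrightarrow> S_component X d S C \<Longrightarrow> D_bounded d (D S) C"
    using assms(2) unfolding uniform_dim_le_0_def by blast
  note d_le = dist_le_chain_dist[OF cont bounded]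
  have "Metric_space X chain_dist"
  proof
    show "0 \<le> chain_dist x y" "chain_dist x y = chain_dist y x" for x y
      by (fact chain_dist_nonneg chain_dist_commute)+
    show "chain_dist x y = 0 \<longleftrightarrow> x = y" if xy: "x \<in> X" "y \<in> X" for x y
    proof
      assume "chain_dist x y = 0"
      \<comment> \<open>Definiteness comes from \<open>D 0 = 0\<close>: points at chain distance 0
        satisfy \<open>d x y \<le> D 0\<close>.\<close>
      then have "d x y \<le> 0"
        using d_le[OF _ _ xy] D0 by simp
      then show "x = y"
        using xy nonneg[of x y] zero by (metis order_antisym)
    next
      assume "x = y"
      then show "chain_dist x y = 0"
        using chain_dist_le_dist[OF xy] chain_dist_nonneg[of x y] xy by simp
    qed
    show "chain_dist x z \<le> chain_dist x y + chain_dist y z"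
      if "x \<in> X" "y \<in> X" "z \<in> X" for x y z
      using chain_dist_ultra[OF that] chain_dist_nonneg[of x y] chain_dist_nonneg[of y z]
      by linarith
  qed
  then have "ultrametric_on X chain_dist"
    using chain_dist_ultra by (simp add: ultrametric_on_def)
  moreover have "uniform_map X d X chain_dist id"
    unfolding uniform_map_def
    \<comment> \<open>Since \<open>chain_dist\<close> is at most \<open>d\<close>, the identity is a
      modulus.\<close>
    by (intro conjI exI[of _ "\<lambda>t. t"]) (auto intro: chain_dist_le_dist tendsto_ident_at)
  moreover have "uniform_map X chain_dist X d (inv_into X id)"
    unfolding uniform_map_def
  \<comment> \<open>In the other direction the control function itself is a modulus, because
    \<open>d x y \<le> D (chain_dist x y)\<close>.\<close>
  proof (intro conjI exI[of _ D])
    have inv: "inv_into X id x = x" if "x \<in> X" for x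
      using inv_into_f_f[of id X x] that by simp
    then show "inv_into X id \<in> X \<rightarrow> X"
      by auto
    show "\<forall>t\<ge>0. 0 \<le> D t"
      using strict_mono_on_leD[OF mono, of 0] D0 by auto
    have "(D \<longlongrightarrow> 0) (at 0 within {0..})"
      using cont D0 by (force simp: continuous_on_def)
    then show "(D \<longlongrightarrow> 0) (at_right 0)"
      by (rule tendsto_within_subset) auto
    show "\<forall>x\<in>X. \<forall>x'\<in>X. d (inv_into X id x) (inv_into X id x') \<le> D (chain_dist x x')"
      using d_le by (simp add: inv)
  qed
  ultimately show ?thesis
    unfolding bi_uniform_map_def using bij_betw_id by blast
qed

end
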